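(* Let $n,N\ge 1$ be integers and let $\omega_1,\dots,\omega_N>0$. Let $f\colon\mathbb{R}^{nN}\to\mathbb{R}$ be defined, for every $\boldsymbol{x}=(x_1,\dots,x_N)$ with $x_i\in\mathbb{R}^n$, by $$f(\boldsymbol{x})=\max_{1\le i\le N}-\omega_i\|x_i\|^2 .$$ Then $f\in\Gamma_\rho(\mathbb{R}^{nN})$ with $\rho=2\max_{1\le i\le N}\omega_i$. Moreover, let $\boldsymbol{x}\in\mathbb{R}^{nN}$ and $0<\mu<1/\rho$, and for every $i\in\{1,\dots,N\}$ put $\mu_i=\mu\omega_i$ and $\alpha_i=\omega_i\|x_i\|^2$. Then $$\operatorname{prox}_{\mu f}(\boldsymbol{x})=\left(\frac{x_i}{1-2\mu_i\overline{p}_i}\right)_{i=1}^{N},$$ where $\overline{p}\in\mathbb{R}^N$ is a solution to $$\max_{p\in\Delta_N}\ \sum_{i=1}^{N}\frac{\alpha_i p_i}{2\mu_i p_i-1}.$$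
   Context: $\|\cdot\|$ is the Euclidean norm. $\Delta_N=\{p\in\mathbb{R}^N : p_i\ge 0 \text{ for all } i,\ \sum_{i=1}^N p_i=1\}$. $\Gamma_0(\mathbb{R}^m)$ is the set of convex, lower semicontinuous, proper functions from $\mathbb{R}^m$ to $\mathbb{R}\cup\{+\infty\}$. For $\rho\ge 0$, $\Gamma_\rho(\mathbb{R}^m)$ (the $\rho$-weakly convex functions) is the set of $f\colon\mathbb{R}^m\to\mathbb{R}\cup\{+\infty\}$ such that $f+\frac{\rho}{2}\|\cdot\|^2\in\Gamma_0(\mathbb{R}^m)$. For $f\in\Gamma_\rho(\mathbb{R}^m)$ and $0<\mu<1/\rho$, $\operatorname{prox}_{\mu f}(x)$ denotes the unique minimizer over $y\in\mathbb{R}^m$ of $f(y)+\frac{1}{2\mu}\|y-x\|^2$. *)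

theory Defs
  imports "HOL-Analysis.Analysis"
begin

text \<open>
  Functions with values in the reals together with \<open>+\<infinity>\<close> are rendered as \<open>ereal\<close>-valued functions;
  the value \<open>-\<infinity>\<close> is excluded by properness.
\<close>

definition proper_fun :: "('a \<Rightarrow> ereal) \<Rightarrow> bool"
  where "proper_fun f \<longleftrightarrow> (\<forall>x. f x \<noteq> -\<infinity>) \<and> (\<exists>x. f x \<noteq> \<infinity>)"

(* For ereal, 0 * \<infinity> = 0; restricting to 0 < t < 1 keeps that convention out of the inequality. *)
definition convex_fun :: "('a::real_vector \<Rightarrow> ereal) \<Rightarrow> bool"
  where "convex_fun f \<longleftrightarrow>
    (\<forall>x y t. 0 < t \<and> t < 1 \<longrightarrow>
      f ((1 - t) *\<^sub>R x + t *\<^sub>R y) \<le> ereal (1 - t) * f x + ereal t * f y)"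

definition lsc_fun :: "('a::topological_space \<Rightarrow> ereal) \<Rightarrow> bool"
  where "lsc_fun f \<longleftrightarrow> (\<forall>x. f x \<le> Liminf (at x) f)"

definition Gamma0 :: "('a::euclidean_space \<Rightarrow> ereal) set"
  where "Gamma0 = {f. convex_fun f \<and> lsc_fun f \<and> proper_fun f}"

(* Membership forces f x \<noteq> -\<infinity>, since -\<infinity> plus a real number is -\<infinity>. *)
definition weakly_convex :: "real \<Rightarrow> ('a::euclidean_space \<Rightarrow> ereal) set"
  where "weakly_convex \<rho> = {f. (\<lambda>x. f x + ereal (\<rho> / 2 * (norm x)\<^sup>2)) \<in> Gamma0}"

(* Meaningful when the minimizer is unique, in particular if f is \<rho>-weakly convex and
   0 < \<mu> < 1/\<rho>. *)
definition prox :: "real \<Rightarrow> ('a::euclidean_space \<Rightarrow> ereal) \<Rightarrow> 'a \<Rightarrow> 'a"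
  where "prox \<mu> f x =
    (THE y. is_arg_min (\<lambda>y. f y + ereal (1 / (2 * \<mu>) * (norm (y - x))\<^sup>2)) (\<lambda>y. True) y)"

definition unit_simplex :: "(real ^ 'N) set"
  where "unit_simplex = {p. (\<forall>i. 0 \<le> p $ i) \<and> (\<Sum>i\<in>UNIV. p $ i) = 1}"

end

theory Submission
  imports Defs
begin

text \<open>
  Put \<open>L(y,p) = (\<Sum>i. - p\<^sub>i \<omega>\<^sub>i \<parallel>y\<^sub>i\<parallel>\<^sup>2) + \<parallel>y - x\<parallel>\<^sup>2 / (2\<mu>)\<close>, so that the objective of the proximity
  operator is the maximum of \<open>L(y,\<cdot>)\<close> over the simplex. For fixed \<open>p\<close>, \<open>L(\<cdot>,p)\<close> is a strictly
  convex quadratic with minimizer \<open>z\<^sub>i = x\<^sub>i / (1 - 2 \<mu> \<omega>\<^sub>i p\<^sub>i)\<close>, and its minimum is the dual objective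
  \<open>\<Sum>i. \<alpha>\<^sub>i p\<^sub>i / (2 \<mu>\<^sub>i p\<^sub>i - 1)\<close>. The partial derivatives of the latter are \<open>- \<omega>\<^sub>i \<parallel>z\<^sub>i\<parallel>\<^sup>2\<close>; hence the
  first-order condition at a dual solution says that \<open>p\<close> maximizes \<open>L(z,\<cdot>)\<close>, i.e. that \<open>(z,p)\<close>
  is a saddle point, and \<open>z\<close> is the unique minimizer.
\<close>

section \<open>Convexity of squared norms, sums and maxima, and membership in
  \<open>Gamma0\<close>\<close>

lemma norm_vec_power2: "(norm x)\<^sup>2 = (\<Sum>i\<in>UNIV. (norm (x $ i))\<^sup>2)"
  for x :: "'a::real_normed_vector ^ 'n::finite"
  by (simp add: norm_vec_def L2_set_def sum_nonneg)

text \<open>The convexity gap of the squared norm equals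
  \<open>t * (1 - t) * (norm (a - b))\<^sup>2\<close> for the components \<open>a\<close> and
  \<open>b\<close>.\<close>

lemma convex_on_norm_component_power2:
  "convex_on UNIV (\<lambda>x :: ('a::real_inner) ^ ('n::finite). (norm (x $ i))\<^sup>2)"
proof (rule convex_onI)
  fix t :: real and x y :: "'a ^ 'n"
  assume t: "0 < t" "t < 1"
  let ?a = "x $ i" and ?b = "y $ i"
  have "(1 - t) * (norm ?a)\<^sup>2 + t * (norm ?b)\<^sup>2 - (norm ((1 - t) *\<^sub>R ?a + t *\<^sub>R ?b))\<^sup>2
      = t * (1 - t) * (norm (?a - ?b))\<^sup>2"
    by (simp add: power2_norm_eq_inner inner_add_left inner_add_right inner_diff_left
        inner_diff_right inner_commute algebra_simps)
  moreover have "0 \<le> t * (1 - t) * (norm (?a - ?b))\<^sup>2"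
    using t by simp
  ultimately show "(norm (((1 - t) *\<^sub>R x + t *\<^sub>R y) $ i))\<^sup>2
      \<le> (1 - t) * (norm ?a)\<^sup>2 + t * (norm ?b)\<^sup>2"
    by simp
qed simp

lemma convex_on_sum_fun:
  fixes g :: "'i \<Rightarrow> 'a::real_vector \<Rightarrow> real"
  assumes "convex S" "\<And>i. i \<in> I \<Longrightarrow> convex_on S (g i)"
  shows "convex_on S (\<lambda>x. \<Sum>i\<in>I. g i x)"
  using assms(2)
  by (induction I rule: infinite_finite_induct)
    (auto simp: assms(1) convex_on_const intro!: convex_on_add)

lemma convex_on_Max:
  fixes g :: "'i \<Rightarrow> 'a::real_vector \<Rightarrow> real"
  assumes "finite I" "I \<noteq> {}" and g: "\<And>i. i \<in> I \<Longrightarrow> convex_on S (g i)"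
  shows "convex_on S (\<lambda>x. MAX i\<in>I. g i x)"
proof (rule convex_onI)
  show "convex S"
    using assms convex_on_imp_convex by blast
  fix t :: real and x y
  assume t: "0 < t" "t < 1" and xy: "x \<in> S" "y \<in> S"
  have "g i ((1 - t) *\<^sub>R x + t *\<^sub>R y) \<le> (1 - t) * (MAX i\<in>I. g i x) + t * (MAX i\<in>I. g i y)"
    if "i \<in> I" for i
  proof -
    have "g i ((1 - t) *\<^sub>R x + t *\<^sub>R y) \<le> (1 - t) * g i x + t * g i y"
      using convex_onD[OF g[OF that], of t x y] t xy by simp
    also have "\<dots> \<le> (1 - t) * (MAX i\<in>I. g i x) + t * (MAX i\<in>I. g i y)"
      using t that assms by (intro add_mono mult_left_mono) auto
    finally show ?thesis .
  qed
  then show "(MAX i\<in>I. g i ((1 - t) *\<^sub>R x + t *\<^sub>R y))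
      \<le> (1 - t) * (MAX i\<in>I. g i x) + t * (MAX i\<in>I. g i y)"
    using assms by simp
qed

text \<open>A real-valued convex function on a Euclidean space is continuous, hence lower
  semicontinuous; finiteness gives properness.\<close>

lemma convex_on_imp_Gamma0:
  fixes F :: "'a::euclidean_space \<Rightarrow> real"
  assumes "convex_on UNIV F"
  shows "(\<lambda>x. ereal (F x)) \<in> Gamma0"
proof -
  have "lsc_fun (\<lambda>x. ereal (F x))"
    unfolding lsc_fun_def
  proof
    fix x
    have "isCont F x"
      using convex_on_continuous[OF open_UNIV assms] by (simp add: continuous_on_eq_continuous_at)
    then have "((\<lambda>x. ereal (F x)) \<longlongrightarrow> ereal (F x)) (at x)"
      unfolding isCont_def by (rule tendsto_ereal)
    then show "ereal (F x) \<le> Liminf (at x) (\<lambda>x. ereal (F x))"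
      by (simp only: lim_imp_Liminf[OF at_neq_bot] order_refl)
  qed
  moreover have "convex_fun (\<lambda>x. ereal (F x))"
    using convex_onD[OF assms] by (simp add: convex_fun_def)
  ultimately show ?thesis
    by (simp add: Gamma0_def proper_fun_def)
qed

section \<open>The simplex and first-order optimality on it\<close>

lemma compact_unit_simplex: "compact (unit_simplex :: (real ^ 'N::finite) set)"
proof -
  have "unit_simplex = (\<Inter>i. {p :: real ^ 'N. 0 \<le> p $ i}) \<inter> {p. (\<Sum>i\<in>UNIV. p $ i) = 1}"
    by (auto simp: unit_simplex_def)
  moreover have "closed ((\<Inter>i. {p :: real ^ 'N. 0 \<le> p $ i}) \<inter> {p. (\<Sum>i\<in>UNIV. p $ i) = 1})"
    by (intro closed_Int closed_INT ballI closed_Collect_le closed_Collect_eq continuous_intros)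
  moreover have "norm p \<le> 1" if "p \<in> unit_simplex" for p :: "real ^ 'N"
    using that norm_le_l1_cart[of p] by (simp add: unit_simplex_def)
  ultimately show ?thesis
    by (auto simp: compact_eq_bounded_closed bounded_iff)
qed

lemma axis_in_unit_simplex: "axis j 1 \<in> unit_simplex"
  by (auto simp: unit_simplex_def axis_def)

lemma unit_simplex_le_1:
  assumes "p \<in> unit_simplex"
  shows "p $ i \<le> 1"
proof -
  have "p $ i \<le> (\<Sum>i\<in>UNIV. p $ i)"
    using assms by (intro member_le_sum) (auto simp: unit_simplex_def)
  then show ?thesis
    using assms by (simp add: unit_simplex_def)
qed

lemma convex_unit_simplex: "convex (unit_simplex :: (real ^ 'N::finite) set)"
  by (rule convexI) (auto simp: unit_simplex_def sum.distrib simp flip: sum_distrib_left)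

lemma sum_unit_simplex_le_Max:
  fixes a :: "'N::finite \<Rightarrow> real"
  assumes "p \<in> unit_simplex"
  shows "(\<Sum>i\<in>UNIV. p $ i * a i) \<le> (MAX i\<in>UNIV. a i)"
proof -
  have "(\<Sum>i\<in>UNIV. p $ i * a i) \<le> (\<Sum>i\<in>UNIV. p $ i * (MAX i\<in>UNIV. a i))"
    using assms by (intro sum_mono mult_left_mono) (auto simp: unit_simplex_def)
  also have "\<dots> = (MAX i\<in>UNIV. a i)"
    using assms by (simp add: unit_simplex_def flip: sum_distrib_right)
  finally show ?thesis .
qed

text \<open>The derivative of the separable objective at \<open>p\<close> towards the vertex
  \<open>axis j 1\<close> is \<open>g' j\<close> minus the average of \<open>g'\<close> under
  \<open>p\<close>. Were it positive, a short move towards that vertex would improve on the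
  maximizer.\<close>

lemma unit_simplex_first_order_condition:
  fixes g :: "'N::finite \<Rightarrow> real \<Rightarrow> real" and g' :: "'N \<Rightarrow> real"
  assumes max: "is_arg_max (\<lambda>p. \<Sum>i\<in>UNIV. g i (p $ i)) (\<lambda>p. p \<in> unit_simplex) p"
    and deriv: "\<And>i. (g i has_real_derivative g' i) (at (p $ i))"
  shows "g' j \<le> (\<Sum>i\<in>UNIV. p $ i * g' i)"
proof (rule ccontr)
  let ?q = "\<lambda>t. (1 - t) *\<^sub>R p + t *\<^sub>R axis j 1"
  let ?h = "\<lambda>t. \<Sum>i\<in>UNIV. g i (?q t $ i)"
  assume "\<not> ?thesis"
  then have pos: "0 < g' j - (\<Sum>i\<in>UNIV. p $ i * g' i)"
    by simp
  have p: "p \<in> unit_simplex"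
    using max by (simp add: is_arg_max_def)
  have "(?h has_real_derivative (\<Sum>i\<in>UNIV. g' i * (axis j 1 $ i - p $ i))) (at 0)"
  proof (rule DERIV_sum)
    fix i
    have "((\<lambda>t. ?q t $ i) has_real_derivative axis j 1 $ i - p $ i) (at 0)"
      by (auto intro!: derivative_eq_intros)
    moreover have "(g i has_real_derivative g' i) (at (?q 0 $ i))"
      using deriv by simp
    ultimately show "((\<lambda>t. g i (?q t $ i)) has_real_derivative g' i * (axis j 1 $ i - p $ i)) (at 0)"
      by (rule DERIV_chain2[rotated])
  qed
  also have "(\<Sum>i\<in>UNIV. g' i * (axis j 1 $ i - p $ i)) = g' j - (\<Sum>i\<in>UNIV. p $ i * g' i)"
    by (simp add: axis_def right_diff_distrib sum_subtractf mult.commute[of "g' _" "p $ _"]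
        if_distrib[of "\<lambda>a. _ * a"] cong: if_cong)
  finally obtain d where d: "d > 0" "\<And>t. 0 < t \<Longrightarrow> t < d \<Longrightarrow> ?h 0 < ?h (0 + t)"
    using DERIV_pos_inc_right[OF _ pos] by blast
  \<comment> \<open>Below \<open>d\<close> the objective has strictly increased; the cap at 1 keeps
    the point on the segment, hence in the simplex.\<close>
  define t where "t = min (d / 2) 1"
  have t: "0 < t" "t < d" "t \<le> 1"
    using d(1) by (auto simp: t_def)
  have "?q t \<in> unit_simplex"
    using convexD[OF convex_unit_simplex p axis_in_unit_simplex, of "1 - t" t] t by simp
  then have "?h t \<le> ?h 0"
    using max by (auto simp: is_arg_max_def not_less)
  with d(2)[OF t(1,2)] show False
    by simp
qed

section \<open>Strict minimizers and the quadratic behind the proximity operator\<close>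

lemma prox_eqI:
  assumes "\<And>y. y \<noteq> z \<Longrightarrow> f z + 1 / (2 * \<mu>) * (norm (z - x))\<^sup>2 < f y + 1 / (2 * \<mu>) * (norm (y - x))\<^sup>2"
  shows "prox \<mu> (\<lambda>x. ereal (f x)) x = z"
  unfolding prox_def
proof (rule the_equality)
  show "is_arg_min (\<lambda>y. ereal (f y) + ereal (1 / (2 * \<mu>) * (norm (y - x))\<^sup>2)) (\<lambda>y. True) z"
    using assms by (force simp: is_arg_min_def)
next
  fix y
  assume "is_arg_min (\<lambda>y. ereal (f y) + ereal (1 / (2 * \<mu>) * (norm (y - x))\<^sup>2)) (\<lambda>y. True) y"
  then show "y = z"
    using assms[of y] by (auto simp: is_arg_min_def)
qed

text \<open>With base point \<open>d *\<^sub>R z\<close>, the left side is a quadratic in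
  \<open>y\<close> with leading coefficient \<open>1 / (2 * \<mu>) - c = d / (2 * \<mu>)\<close>.
  Its gradient vanishes at \<open>z\<close>, so its expansion there has no linear term.\<close>

lemma complete_square_prox:
  fixes y z :: "'a::real_inner"
  assumes "\<mu> \<noteq> 0" "d = 1 - 2 * \<mu> * c"
  shows "- c * (norm y)\<^sup>2 + 1 / (2 * \<mu>) * (norm (y - d *\<^sub>R z))\<^sup>2
    = - c * (norm z)\<^sup>2 + 1 / (2 * \<mu>) * (norm (z - d *\<^sub>R z))\<^sup>2 + d / (2 * \<mu>) * (norm (y - z))\<^sup>2"
proof -
  have c: "c = (1 - d) / (2 * \<mu>)"
    using assms by simp
  show ?thesis
    using assms(1) unfolding c
    by (simp add: power2_norm_eq_inner inner_diff_left inner_diff_right inner_commute field_simps)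
qed

theorem proposition2p3:
  fixes \<omega> :: "'N::finite \<Rightarrow> real"
    and f :: "(real ^ 'n::finite) ^ 'N \<Rightarrow> real"
    and \<rho> :: real
  assumes \<omega>_pos: "\<And>i. \<omega> i > 0"
    and f_eq: "\<And>x. f x = (MAX i\<in>UNIV. - \<omega> i * (norm (x $ i))\<^sup>2)"
    and \<rho>_eq: "\<rho> = 2 * (MAX i\<in>UNIV. \<omega> i)"
  shows "(\<lambda>x. ereal (f x)) \<in> weakly_convex \<rho> \<and>
    (\<forall>(x :: (real ^ 'n) ^ 'N) (\<mu> :: real) (m :: 'N \<Rightarrow> real) (\<alpha> :: 'N \<Rightarrow> real)
        (sol :: real ^ 'N \<Rightarrow> bool).
      0 < \<mu> \<and> \<mu> < 1 / \<rho> \<and>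
      (\<forall>i. m i = \<mu> * \<omega> i) \<and>
      (\<forall>i. \<alpha> i = \<omega> i * (norm (x $ i))\<^sup>2) \<and>
      (\<forall>p. sol p \<longleftrightarrow>
        is_arg_max (\<lambda>p. \<Sum>i\<in>UNIV. \<alpha> i * p $ i / (2 * m i * p $ i - 1)) (\<lambda>p. p \<in> unit_simplex) p)
      \<longrightarrow>
      (\<exists>p. sol p) \<and>
      (\<forall>p. sol p \<longrightarrow>
        prox \<mu> (\<lambda>x. ereal (f x)) x = (\<chi> i. (1 / (1 - 2 * m i * p $ i)) *\<^sub>R x $ i)))"
proof (intro conjI allI impI)
  have \<omega>_le: "2 * \<omega> i \<le> \<rho>" for i
    by (simp add: \<rho>_eq)
  have "convex_on UNIV (\<lambda>x. f x + \<rho> / 2 * (norm x)\<^sup>2)"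
  proof -
    \<comment> \<open>Adding the quadratic to the \<open>i\<close>-th branch of \<open>f\<close>
      gives a diagonal form with these coefficients, nonnegative because
      \<open>2 * \<omega> i \<le> \<rho>\<close>.\<close>
    let ?c = "\<lambda>i j. \<rho> / 2 - (if j = i then \<omega> i else 0)"
    have "convex_on UNIV (\<lambda>x. MAX i\<in>UNIV. \<Sum>j\<in>UNIV. ?c i j * (norm ((x :: (real ^ 'n) ^ 'N) $ j))\<^sup>2)"
    proof (intro convex_on_Max convex_on_sum_fun convex_on_cmul convex_on_norm_component_power2)
      show "0 \<le> ?c i j" for i j
        using \<omega>_le[of i] \<omega>_pos[of i] by auto
    qed auto
    moreover have "f x + \<rho> / 2 * (norm x)\<^sup>2
        = (MAX i\<in>UNIV. \<Sum>j\<in>UNIV. ?c i j * (norm (x $ j))\<^sup>2)" for x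
    proof -
      have "(\<Sum>j\<in>UNIV. ?c i j * (norm (x $ j))\<^sup>2)
          = - \<omega> i * (norm (x $ i))\<^sup>2 + \<rho> / 2 * (norm x)\<^sup>2" for i
        by (simp add: norm_vec_power2[of x] left_diff_distrib sum_subtractf sum_distrib_left
            if_distrib[of "\<lambda>a. a * _"] cong: if_cong)
      then show ?thesis
        by (simp only: f_eq Max_add_commute[OF finite UNIV_not_empty])
    qed
    ultimately show ?thesis
      by simp
  qed
  then show "(\<lambda>x. ereal (f x)) \<in> weakly_convex \<rho>"
    using convex_on_imp_Gamma0 by (force simp: weakly_convex_def)

  fix x :: "(real ^ 'n) ^ 'N" and \<mu> :: real and m \<alpha> :: "'N \<Rightarrow> real" and sol :: "real ^ 'N \<Rightarrow> bool"
  let ?g = "\<lambda>i s. \<alpha> i * s / (2 * m i * s - 1)"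
  assume "0 < \<mu> \<and> \<mu> < 1 / \<rho> \<and> (\<forall>i. m i = \<mu> * \<omega> i) \<and> (\<forall>i. \<alpha> i = \<omega> i * (norm (x $ i))\<^sup>2) \<and>
    (\<forall>p. sol p \<longleftrightarrow> is_arg_max (\<lambda>p. \<Sum>i\<in>UNIV. ?g i (p $ i)) (\<lambda>p. p \<in> unit_simplex) p)"
  then have \<mu>: "0 < \<mu>" "\<mu> < 1 / \<rho>" and m: "\<And>i. m i = \<mu> * \<omega> i"
    and \<alpha>: "\<And>i. \<alpha> i = \<omega> i * (norm (x $ i))\<^sup>2"
    and sol: "\<And>p. sol p \<longleftrightarrow> is_arg_max (\<lambda>p. \<Sum>i\<in>UNIV. ?g i (p $ i)) (\<lambda>p. p \<in> unit_simplex) p"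
    by auto
  have "0 < \<rho>"
    using \<omega>_le \<omega>_pos by (meson less_le_trans mult_pos_pos zero_less_numeral)
  \<comment> \<open>The bounds \<open>p $ i \<le> 1\<close> and \<open>\<mu> * \<rho> < 1\<close>
    keep the dual objective away from its poles, so it is continuous on the simplex.\<close>
  have denom: "2 * m i * p $ i < 1" if "p \<in> unit_simplex" for p i
  proof -
    have "2 * m i * p $ i \<le> 2 * m i * 1"
      using unit_simplex_le_1[OF that] \<mu> \<omega>_pos[of i] by (intro mult_left_mono) (auto simp: m)
    also have "\<dots> \<le> \<mu> * \<rho>"
      using \<omega>_le[of i] \<mu> by (simp add: m)
    also have "\<dots> < 1"
      using \<mu> \<open>0 < \<rho>\<close> by (simp add: field_simps)
    finally show ?thesis .
  qed

  show "\<exists>p. sol p"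
  proof -
    have "continuous_on unit_simplex (\<lambda>p. \<Sum>i\<in>UNIV. ?g i (p $ i))"
      using denom by (intro continuous_intros ballI) (metis diff_0_right diff_eq_diff_eq less_irrefl)+
    then obtain p where "p \<in> unit_simplex"
      and "\<forall>q\<in>unit_simplex. (\<Sum>i\<in>UNIV. ?g i (q $ i)) \<le> (\<Sum>i\<in>UNIV. ?g i (p $ i))"
      using continuous_attains_sup[OF compact_unit_simplex] axis_in_unit_simplex by blast
    then show ?thesis
      by (auto simp: sol is_arg_max_def not_less intro!: exI[of _ p])
  qed

  fix p
  assume "sol p"
  then have p_max: "is_arg_max (\<lambda>p. \<Sum>i\<in>UNIV. ?g i (p $ i)) (\<lambda>p. p \<in> unit_simplex) p"
    by (simp add: sol)
  then have p: "p \<in> unit_simplex"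
    by (simp add: is_arg_max_def)
  define d where "d i = 1 - 2 * m i * p $ i" for i
  have d: "0 < d i" for i
    using denom[OF p] by (simp add: d_def)
  define z where "z = (\<chi> i. (1 / d i) *\<^sub>R x $ i)"
  have xz: "x $ i = d i *\<^sub>R z $ i" for i
    using d[of i] by (simp add: z_def)
  \<comment> \<open>The quotient rule gives \<open>- \<alpha> i / (d i)\<^sup>2\<close>, and
    \<open>x $ i = d i *\<^sub>R z $ i\<close> cancels the square.\<close>
  have "(?g i has_real_derivative - \<omega> i * (norm (z $ i))\<^sup>2) (at (p $ i))" for i
  proof -
    have "2 * m i * p $ i - 1 = - d i"
      by (simp add: d_def)
    then have "(?g i has_real_derivative
        (\<alpha> i * (- d i) - \<alpha> i * p $ i * (2 * m i)) / (- d i * - d i)) (at (p $ i))"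
      using d[of i] by (auto intro!: derivative_eq_intros)
    moreover have "\<alpha> i * (- d i) - \<alpha> i * p $ i * (2 * m i) = - \<alpha> i"
      by (simp add: d_def algebra_simps)
    moreover have "\<alpha> i = \<omega> i * (norm (z $ i))\<^sup>2 * (d i * d i)"
      by (simp add: \<alpha> xz power_mult_distrib power2_eq_square)
    ultimately show ?thesis
      using d[of i] by simp
  qed
  \<comment> \<open>The condition holds for every vertex \<open>j\<close>, so the largest branch
    value at \<open>z\<close>, which is \<open>f z\<close>, is at most the average under
    \<open>p\<close>.\<close>
  from unit_simplex_first_order_condition[OF p_max this]
  have fz: "f z \<le> (\<Sum>i\<in>UNIV. p $ i * (- \<omega> i * (norm (z $ i))\<^sup>2))"
    by (simp add: f_eq)
  let ?L = "\<lambda>y. (\<Sum>i\<in>UNIV. p $ i * (- \<omega> i * (norm (y $ i))\<^sup>2)) + 1 / (2 * \<mu>) * (norm (y - x))\<^sup>2"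
  \<comment> \<open>Completing the square in each component with
    \<open>c = p $ i * \<omega> i\<close> shows that \<open>?L\<close> exceeds its value at
    \<open>z\<close> by a weighted squared distance.\<close>
  have L: "?L y = ?L z + (\<Sum>i\<in>UNIV. d i / (2 * \<mu>) * (norm (y $ i - z $ i))\<^sup>2)" for y
  proof -
    have sq: "- (p $ i * \<omega> i) * (norm (y $ i))\<^sup>2 + 1 / (2 * \<mu>) * (norm (y $ i - x $ i))\<^sup>2
      = - (p $ i * \<omega> i) * (norm (z $ i))\<^sup>2 + 1 / (2 * \<mu>) * (norm (z $ i - x $ i))\<^sup>2
        + d i / (2 * \<mu>) * (norm (y $ i - z $ i))\<^sup>2" for i
      unfolding xz using \<mu> by (intro complete_square_prox) (auto simp: d_def m)
    have "?L w = (\<Sum>i\<in>UNIV. - (p $ i * \<omega> i) * (norm (w $ i))\<^sup>2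
        + 1 / (2 * \<mu>) * (norm (w $ i - x $ i))\<^sup>2)" for w
      by (simp add: norm_vec_power2[of "w - x"] sum_subtractf sum_negf sum_distrib_left mult.assoc)
    then show ?thesis
      by (simp only: sq flip: sum.distrib)
  qed
  have "prox \<mu> (\<lambda>x. ereal (f x)) x = z"
  proof (rule prox_eqI)
    fix y
    assume "y \<noteq> z"
    then obtain j where "y $ j \<noteq> z $ j"
      by (auto simp: vec_eq_iff)
    \<comment> \<open>All weights are positive, so one differing component makes the excess
      strict.\<close>
    then have "0 < (\<Sum>i\<in>UNIV. d i / (2 * \<mu>) * (norm (y $ i - z $ i))\<^sup>2)"
      using d \<mu> by (intro sum_pos2[of _ j]) (auto simp: less_imp_le)
    then have "?L z < ?L y"
      using L[of y] by linarith
    moreover have "?L y \<le> f y + 1 / (2 * \<mu>) * (norm (y - x))\<^sup>2"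
      using sum_unit_simplex_le_Max[OF p, of "\<lambda>i. - \<omega> i * (norm (y $ i))\<^sup>2"] by (simp add: f_eq)
    \<comment> \<open>By \<open>fz\<close>, the objective at \<open>z\<close> is at most
      \<open>?L z\<close>, which is below \<open>?L y\<close>, and this is at most the objective at
      \<open>y\<close>.\<close>
    ultimately show "f z + 1 / (2 * \<mu>) * (norm (z - x))\<^sup>2 < f y + 1 / (2 * \<mu>) * (norm (y - x))\<^sup>2"
      using fz by linarith
  qed
  then show "prox \<mu> (\<lambda>x. ereal (f x)) x = (\<chi> i. (1 / (1 - 2 * m i * p $ i)) *\<^sub>R x $ i)"
    by (simp add: z_def d_def)
qed

end
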